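(* Let $a\in(0,1)$, $b>0$, $V>0$, $\kappa_1>0$, $\kappa_2<0$, $P_C>0$ be real numbers, and consider the temperature iteration $$T[k+1]=aT[k]+b\left(P_C+V\kappa_1T[k]^2e^{\kappa_2/T[k]}\right),\qquad T[0]>0,$$ together with the auxiliary variable $\tilde T[k]=-\kappa_2/T[k]\in(0,\infty)$. Put $$\alpha=\frac{b}{a-1}\frac{P_C}{\kappa_2}>0,\qquad \beta=\frac{a-1}{b}\frac{1}{V\kappa_1\kappa_2}>0,\qquad \tilde T_m=\frac{1}{2\alpha}-1+\sqrt{\frac{1}{4\alpha^2}+1},$$ and for $\tilde T\in(0,1/\alpha)$ let $\mathcal{F}(\tilde T)=\ln\beta+\ln\tilde T+\ln(1-\alpha\tilde T)+\tilde T$. Then: (1) If $\mathcal{F}(\tilde T)=0$ has no solution in $(0,1/\alpha)$, then the temperature iteration diverges from every starting value: $\tilde T[k]\to0$, i.e. $T[k]\to\infty$, as $k\to\infty$ (thermal runaway). (2) If $\mathcal{F}(\tilde T)=0$ has two distinct solutions (fixed points), then one of them, $\tilde T_u$, lies in $(0,\tilde T_m)$ and is unstable, and the other, $\tilde T_s$, lies in $(\tilde T_m,1/\alpha)$ and is stable. (3) In the case of (2), every iteration with $\tilde T[0]\in(0,\tilde T_u)$ diverges, i.e. $\tilde T[k]\to0$ and $T[k]\to\infty$ (thermal runaway), while every iteration with $\tilde T[0]\in(\tilde T_u,1/\alpha)$ satisfies $\tilde T[k]\to\tilde T_s$.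
   Context: Solutions of $\mathcal{F}(\tilde T)=0$ correspond, via $T=-\kappa_2/\tilde T$, exactly to the fixed points of the temperature iteration. A fixed point is called stable if it attracts nearby trajectories, i.e. every iteration started sufficiently close to it converges to it; it is called unstable if it is not stable. *)

theory Defs
  imports Complex_Main
begin

definition temp_map :: "real \<Rightarrow> real \<Rightarrow> real \<Rightarrow> real \<Rightarrow> real \<Rightarrow> real \<Rightarrow> real \<Rightarrow> real" where
  "temp_map a b V \<kappa>1 \<kappa>2 P\<^sub>C T = a * T + b * (P\<^sub>C + V * \<kappa>1 * T\<^sup>2 * exp (\<kappa>2 / T))"

text \<open>Temperatures live in \<open>(0, \<infinity>)\<close>; every iteration starts there.\<close>

definition iteration :: "(real \<Rightarrow> real) \<Rightarrow> (nat \<Rightarrow> real) \<Rightarrow> bool" where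
  "iteration f T \<longleftrightarrow> T 0 > 0 \<and> (\<forall>k. T (Suc k) = f (T k))"

definition fixed_point :: "(real \<Rightarrow> real) \<Rightarrow> real \<Rightarrow> bool" where
  "fixed_point f p \<longleftrightarrow> p > 0 \<and> f p = p"

definition attracts_nearby :: "(real \<Rightarrow> real) \<Rightarrow> real \<Rightarrow> bool" where
  "attracts_nearby f p \<longleftrightarrow>
     (\<exists>\<epsilon>>0. \<forall>T. iteration f T \<and> \<bar>T 0 - p\<bar> < \<epsilon> \<longrightarrow> T \<longlonglongrightarrow> p)"

text \<open>Stability here is local attractivity, not Lyapunov stability.\<close>

definition stable_fixed_point :: "(real \<Rightarrow> real) \<Rightarrow> real \<Rightarrow> bool" where
  "stable_fixed_point f p \<longleftrightarrow> fixed_point f p \<and> attracts_nearby f p"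

definition unstable_fixed_point :: "(real \<Rightarrow> real) \<Rightarrow> real \<Rightarrow> bool" where
  "unstable_fixed_point f p \<longleftrightarrow> fixed_point f p \<and> \<not> attracts_nearby f p"

text \<open>The variable \<open>x\<close> below stands for \<open>-\<kappa>2 / T\<close>. The function is only meant to be
  evaluated on \<open>(0, 1/\<alpha>)\<close>, where both logarithms have positive arguments.\<close>

definition calF :: "real \<Rightarrow> real \<Rightarrow> real \<Rightarrow> real" where
  "calF \<alpha> \<beta> x = ln \<beta> + ln x + ln (1 - \<alpha> * x) + x"

definition F_solution :: "real \<Rightarrow> real \<Rightarrow> real \<Rightarrow> bool" where
  "F_solution \<alpha> \<beta> x \<longleftrightarrow> x \<in> {0<..<1 / \<alpha>} \<and> calF \<alpha> \<beta> x = 0"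

end

theory Submission
  imports Defs
begin

text \<open>With \<open>x = - \<kappa>2 / T\<close>, the increment \<open>f T - T\<close> has the sign of \<open>1 - g x\<close>, where
  \<open>g x = \<beta> * x * (1 - \<alpha> * x) * exp x\<close> equals \<open>exp (calF \<alpha> \<beta> x)\<close> on \<open>(0, 1/\<alpha>)\<close>. On the positive
  axis, \<open>g\<close> increases up to \<open>x\<^sub>m\<close> and decreases afterwards, so the two solutions \<open>x\<^sub>u < x\<^sub>s\<close> of
  \<open>g x = 1\<close> are separated by \<open>x\<^sub>m\<close> and \<open>g > 1\<close> exactly between them. Since \<open>f\<close> is continuous and
  increasing, every orbit is monotone and either converges to the next fixed point in its
  direction or, if there is none, is unbounded.\<close>

section \<open>Scalar iterations\<close>

text \<open>The orbit increases. If it were bounded, it would converge, and continuity would make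
  its limit a fixed point at or above \<open>T 0\<close>, which \<open>above\<close>
  excludes.\<close>

lemma orbit_at_top:
  fixes f :: "real \<Rightarrow> real"
  assumes step: "\<And>k. T (Suc k) = f (T k)"
    and above: "\<And>z. T 0 \<le> z \<Longrightarrow> z < f z"
    and cont: "\<And>z. T 0 \<le> z \<Longrightarrow> isCont f z"
  shows "filterlim T at_top sequentially"
proof -
  have ge: "T 0 \<le> T k" for k
    by (induction k) (use step above in \<open>force+\<close>)
  have inc: "incseq T"
    using above[OF ge] step by (intro incseq_SucI) (simp add: less_imp_le)
  have "\<not> (\<exists>B. \<forall>k. T k \<le> B)"
  proof
    assume "\<exists>B. \<forall>k. T k \<le> B"
    then obtain B where "\<And>k. T k \<le> B" by blast
    with inc obtain L where L: "T \<longlonglongrightarrow> L" using incseq_convergent by blast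
    have "T 0 \<le> L" using LIMSEQ_le_const[OF L] ge by blast
    then have "(\<lambda>k. f (T k)) \<longlonglongrightarrow> f L" using L cont isCont_tendsto_compose by blast
    moreover have "(\<lambda>k. f (T k)) \<longlonglongrightarrow> L" using LIMSEQ_Suc[OF L] step by simp
    ultimately show False
      using LIMSEQ_unique above[OF \<open>T 0 \<le> L\<close>] by fastforce
  qed
  then have "\<exists>N. \<forall>k\<ge>N. Z \<le> T k" for Z
    by (meson incseqD[OF inc] le_less_linear less_imp_le order_trans)
  then show ?thesis
    by (simp add: filterlim_at_top eventually_sequentially)
qed

text \<open>Monotonicity and \<open>f p = p\<close> keep the orbit from jumping past
  \<open>p\<close>. It is then increasing and bounded, and its limit is a fixed point in
  \<open>{T 0..p}\<close>, where \<open>p\<close> is the only one.\<close>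

lemma orbit_tendsto_increasing:
  fixes f :: "real \<Rightarrow> real"
  assumes step: "\<And>k. T (Suc k) = f (T k)"
    and start: "T 0 \<le> p" and fix_p: "f p = p"
    and above: "\<And>z. T 0 \<le> z \<Longrightarrow> z < p \<Longrightarrow> z < f z"
    and mono: "mono_on {T 0..p} f"
    and cont: "\<And>z. T 0 \<le> z \<Longrightarrow> z \<le> p \<Longrightarrow> isCont f z"
  shows "T \<longlonglongrightarrow> p"
proof -
  have above': "z \<le> f z" if "T 0 \<le> z" "z \<le> p" for z
    using above[of z] that fix_p by (cases "z = p") auto
  have range: "T 0 \<le> T k \<and> T k \<le> p" for k
  proof (induction k)
    case (Suc k)
    then show ?case
      using above'[of "T k"] mono_onD[OF mono, of "T k" p] start step[of k] fix_p by auto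
  qed (use start in simp)
  have "incseq T"
    using above' range step by (intro incseq_SucI) simp
  then obtain L where L: "T \<longlonglongrightarrow> L" using range incseq_convergent by blast
  have Lr: "T 0 \<le> L" "L \<le> p"
    using LIMSEQ_le_const[OF L] LIMSEQ_le_const2[OF L] range by blast+
  then have "(\<lambda>k. f (T k)) \<longlonglongrightarrow> f L" using L cont isCont_tendsto_compose by blast
  moreover have "(\<lambda>k. f (T k)) \<longlonglongrightarrow> L" using LIMSEQ_Suc[OF L] step by simp
  ultimately have "f L = L" by (rule LIMSEQ_unique)
  then have "L = p" using above[of L] Lr by force
  with L show ?thesis by simp
qed

text \<open>Reflection at 0 conjugates this to the increasing case.\<close>

lemma orbit_tendsto_decreasing:
  fixes f :: "real \<Rightarrow> real"
  assumes step: "\<And>k. T (Suc k) = f (T k)"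
    and start: "p \<le> T 0" and fix_p: "f p = p"
    and below: "\<And>z. p < z \<Longrightarrow> z \<le> T 0 \<Longrightarrow> f z < z"
    and mono: "mono_on {p..T 0} f"
    and cont: "\<And>z. p \<le> z \<Longrightarrow> z \<le> T 0 \<Longrightarrow> isCont f z"
  shows "T \<longlonglongrightarrow> p"
proof -
  have "(\<lambda>k. - T k) \<longlonglongrightarrow> - p"
  proof (rule orbit_tendsto_increasing[where f = "\<lambda>z. - f (- z)"])
    show "z < - f (- z)" if "- T 0 \<le> z" "z < - p" for z
      using below[of "- z"] that by simp
    show "mono_on {- T 0..- p} (\<lambda>z. - f (- z))"
      using mono by (auto simp: mono_on_def)
    show "isCont (\<lambda>z. - f (- z)) z" if "- T 0 \<le> z" "z \<le> - p" for z
      using cont[of "- z"] that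
      by (intro isCont_minus isCont_o2[where g = f and f = uminus]) auto
  qed (use step start fix_p in auto)
  then show ?thesis by (simp add: tendsto_minus_cancel_left)
qed

section \<open>The exponential of calF\<close>

text \<open>Unlike \<open>calF\<close>, this makes sense at 0 and beyond 1/\<alpha>, so it also
  governs orbits that start at x \<ge> 1/\<alpha>.\<close>

definition gain :: "real \<Rightarrow> real \<Rightarrow> real \<Rightarrow> real" where
  "gain \<alpha> \<beta> x = \<beta> * x * (1 - \<alpha> * x) * exp x"

text \<open>On the open interval all factors of \<open>gain\<close> are positive, so the logarithms
  in \<open>calF\<close> combine into one.\<close>

lemma F_solution_iff_gain:
  assumes "\<alpha> > 0" "\<beta> > 0"
  shows "F_solution \<alpha> \<beta> x \<longleftrightarrow> 0 < x \<and> x < 1 / \<alpha> \<and> gain \<alpha> \<beta> x = 1"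
proof (cases "0 < x \<and> x < 1 / \<alpha>")
  case True
  then have pos: "x > 0" "1 - \<alpha> * x > 0" using assms by (auto simp: field_simps)
  then have "calF \<alpha> \<beta> x = ln (gain \<alpha> \<beta> x)" "gain \<alpha> \<beta> x > 0"
    using assms by (simp_all add: calF_def gain_def ln_mult)
  then show ?thesis using True by (simp add: F_solution_def)
qed (auto simp: F_solution_def)

lemma gain_nonpos:
  assumes "\<alpha> > 0" "\<beta> > 0" "1 / \<alpha> \<le> x"
  shows "gain \<alpha> \<beta> x \<le> 0"
proof -
  have "x > 0" using assms by (smt (verit) divide_pos_pos)
  moreover have "1 - \<alpha> * x \<le> 0" using assms by (simp add: field_simps)
  ultimately show ?thesis
    using assms by (simp add: gain_def mult_nonneg_nonpos mult_nonpos_nonneg)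
qed

text \<open>Since \<open>gain\<close> is 0 at 0, a value of at least 1 would force a crossing of
  level 1 at a positive point. The crossing lies below 1/\<alpha> because \<open>gain\<close> is
  nonpositive from there on, so it would solve the equation.\<close>

lemma gain_less_1_if_no_solution:
  assumes "\<alpha> > 0" "\<beta> > 0" "\<nexists>x. F_solution \<alpha> \<beta> x" "x > 0"
  shows "gain \<alpha> \<beta> x < 1"
proof (rule ccontr)
  assume ge: "\<not> gain \<alpha> \<beta> x < 1"
  then have x: "x < 1 / \<alpha>" using gain_nonpos[OF assms(1,2), of x] by linarith
  have "continuous_on {0..x} (gain \<alpha> \<beta>)"
    unfolding gain_def by (intro continuous_intros)
  then obtain z where z: "0 \<le> z" "z \<le> x" "gain \<alpha> \<beta> z = 1"
    using IVT'[of "gain \<alpha> \<beta>" 0 1 x] ge \<open>x > 0\<close> by (auto simp: gain_def)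
  then have "z \<noteq> 0" by (auto simp: gain_def)
  then show False
    using z x assms F_solution_iff_gain[of \<alpha> \<beta> z] by auto
qed

section \<open>Critical point and monotone branches of \<open>gain\<close>\<close>

definition peak :: "real \<Rightarrow> real" where
  "peak \<alpha> = 1 / (2 * \<alpha>) - 1 + sqrt (1 / (4 * \<alpha>\<^sup>2) + 1)"

lemma peak_pos:
  assumes "\<alpha> > 0"
  shows "peak \<alpha> > 0"
proof -
  have "sqrt (1 / (4 * \<alpha>\<^sup>2) + 1) > 1" using assms by simp
  moreover have "1 / (2 * \<alpha>) > 0" using assms by simp
  ultimately show ?thesis unfolding peak_def by linarith
qed

text \<open>The derivative is \<beta> * exp x times a concave quadratic with one negative root
  \<open>r\<close> and one positive root \<open>peak \<alpha>\<close>. On the positive axis only the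
  factor \<open>peak \<alpha> - x\<close> can change sign, so the value of \<open>r\<close> can stay
  hidden.\<close>

lemma gain_derivative:
  assumes "\<alpha> > 0"
  obtains r where "r < 0"
    and "\<And>x. (gain \<alpha> \<beta> has_real_derivative \<beta> * exp x * (\<alpha> * (x - r) * (peak \<alpha> - x))) (at x)"
proof
  \<comment> \<open>The roots of the quadratic are \<open>h - s\<close> and \<open>h + s\<close>:
    \<open>h\<close> is their midpoint and \<open>s\<close> half their distance.\<close>
  define h s where "h = 1 / (2 * \<alpha>) - 1" and "s = sqrt (1 / (4 * \<alpha>\<^sup>2) + 1)"
  have s2: "s\<^sup>2 = 1 / (4 * \<alpha>\<^sup>2) + 1" by (simp add: s_def)
  have "(1 / (2 * \<alpha>))\<^sup>2 < s\<^sup>2" unfolding s2 by (simp add: power_divide power_mult_distrib)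
  then have "1 / (2 * \<alpha>) < s" by (rule power2_less_imp_less) (simp add: s_def)
  then show "h - s < 0" by (simp add: h_def)
  \<comment> \<open>Completing the square: this identity explains the radicand in
    \<open>peak\<close>.\<close>
  have s2': "s\<^sup>2 = h\<^sup>2 + 1 / \<alpha>"
    using assms unfolding s2 h_def by (simp add: field_simps power2_eq_square)
  have h': "2 * \<alpha> * h = 1 - 2 * \<alpha>" using assms by (simp add: h_def field_simps)
  fix x
  have "\<alpha> * (x - (h - s)) * (peak \<alpha> - x) = \<alpha> * (s\<^sup>2 - (x - h)\<^sup>2)"
    unfolding peak_def h_def[symmetric] s_def[symmetric] by algebra
  also have "\<dots> = \<alpha> * (1 / \<alpha>) + (2 * \<alpha> * h) * x - \<alpha> * x\<^sup>2"
    unfolding s2' by (simp only: power2_eq_square) algebra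
  finally have factor: "\<alpha> * (x - (h - s)) * (peak \<alpha> - x) = 1 + (1 - 2 * \<alpha>) * x - \<alpha> * x\<^sup>2"
    using assms by (simp add: h')
  show "(gain \<alpha> \<beta> has_real_derivative
      \<beta> * exp x * (\<alpha> * (x - (h - s)) * (peak \<alpha> - x))) (at x)"
    unfolding factor gain_def
    by (rule derivative_eq_intros refl)+ (simp add: algebra_simps power2_eq_square)
qed

lemma gain_strict_increasing:
  assumes "\<alpha> > 0" "\<beta> > 0" "0 \<le> x" "x < y" "y \<le> peak \<alpha>"
  shows "gain \<alpha> \<beta> x < gain \<alpha> \<beta> y"
proof -
  obtain r where r: "r < 0"
    "\<And>x. (gain \<alpha> \<beta> has_real_derivative \<beta> * exp x * (\<alpha> * (x - r) * (peak \<alpha> - x))) (at x)"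
    using gain_derivative[OF assms(1)] by blast
  show ?thesis
  \<comment> \<open>The derivative vanishes at the peak, which may be the endpoint \<open>y\<close>;
    hence the version that asks for positivity only in the open interval.\<close>
  proof (rule DERIV_pos_imp_increasing_open[OF \<open>x < y\<close>])
    fix z assume "x < z" "z < y"
    then have "\<beta> * exp z * (\<alpha> * (z - r) * (peak \<alpha> - z)) > 0" using assms r(1) by simp
    then show "\<exists>D. (gain \<alpha> \<beta> has_real_derivative D) (at z) \<and> D > 0" using r(2) by blast
  qed (auto simp: gain_def intro!: continuous_intros)
qed

lemma gain_strict_decreasing:
  assumes "\<alpha> > 0" "\<beta> > 0" "peak \<alpha> \<le> x" "x < y"
  shows "gain \<alpha> \<beta> y < gain \<alpha> \<beta> x"
proof -
  obtain r where r: "r < 0"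
    "\<And>x. (gain \<alpha> \<beta> has_real_derivative \<beta> * exp x * (\<alpha> * (x - r) * (peak \<alpha> - x))) (at x)"
    using gain_derivative[OF assms(1)] by blast
  show ?thesis
  proof (rule DERIV_neg_imp_decreasing_open[OF \<open>x < y\<close>])
    fix z assume "x < z" "z < y"
    moreover have "0 < z - r" using \<open>x < z\<close> assms r(1) peak_pos[of \<alpha>] by simp
    ultimately have "\<beta> * exp z * (\<alpha> * (z - r) * (peak \<alpha> - z)) < 0"
      using assms by (simp add: mult_pos_neg)
    then show "\<exists>D. (gain \<alpha> \<beta> has_real_derivative D) (at z) \<and> D < 0" using r(2) by blast
  qed (auto simp: gain_def intro!: continuous_intros)
qed

text \<open>Two points at the same level cannot lie on one strictly monotone branch, so the peak
  separates them. The last claim has no upper bound on \<open>x\<close> because the decreasing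
  branch extends to infinity.\<close>

lemma gain_level_1:
  assumes "\<alpha> > 0" "\<beta> > 0" "0 < u" "u < s" "gain \<alpha> \<beta> u = 1" "gain \<alpha> \<beta> s = 1"
  shows "u < peak \<alpha>" "peak \<alpha> < s"
    and "\<And>x. 0 < x \<Longrightarrow> x < u \<Longrightarrow> gain \<alpha> \<beta> x < 1"
    and "\<And>x. u < x \<Longrightarrow> x < s \<Longrightarrow> gain \<alpha> \<beta> x > 1"
    and "\<And>x. s < x \<Longrightarrow> gain \<alpha> \<beta> x < 1"
proof -
  note inc = gain_strict_increasing[OF assms(1,2)] and dec = gain_strict_decreasing[OF assms(1,2)]
  show u: "u < peak \<alpha>" using dec[of u s] assms by force
  show s: "peak \<alpha> < s" using inc[of u s] assms by force
  show "gain \<alpha> \<beta> x < 1" if "0 < x" "x < u" for x using inc[of x u] that u assms by simp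
  show "gain \<alpha> \<beta> x > 1" if "u < x" "x < s" for x
    \<comment> \<open>Left of the peak compare with \<open>u\<close>, right of it with
      \<open>s\<close>.\<close>
    using inc[of u x] dec[of x s] that assms by (cases "x \<le> peak \<alpha>") auto
  show "gain \<alpha> \<beta> x < 1" if "s < x" for x using dec[of s x] that s assms by simp
qed

section \<open>The temperature map\<close>

context
  fixes a b V \<kappa>1 \<kappa>2 P \<alpha> \<beta> :: real
  assumes pars: "0 < a" "a < 1" "b > 0" "V > 0" "\<kappa>1 > 0" "\<kappa>2 < 0" "P > 0"
    and alpha_eq: "\<alpha> = b / (a - 1) * (P / \<kappa>2)"
    and beta_eq: "\<beta> = (a - 1) / b * (1 / (V * \<kappa>1 * \<kappa>2))"
begin

lemma temp_map_pos: "T > 0 \<Longrightarrow> temp_map a b V \<kappa>1 \<kappa>2 P T > 0"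
  using pars by (simp add: temp_map_def add_pos_pos)

lemma iteration_temp_map_pos:
  assumes "iteration (temp_map a b V \<kappa>1 \<kappa>2 P) T"
  shows "T k > 0"
  using assms temp_map_pos by (induction k) (auto simp: iteration_def)

lemma isCont_temp_map: "T > 0 \<Longrightarrow> isCont (temp_map a b V \<kappa>1 \<kappa>2 P) T"
  unfolding temp_map_def by (intro continuous_intros) auto

lemma temp_map_mono:
  assumes "0 < S" "S \<le> T"
  shows "temp_map a b V \<kappa>1 \<kappa>2 P S \<le> temp_map a b V \<kappa>1 \<kappa>2 P T"
proof -
  \<comment> \<open>As \<kappa>2 is negative, the exponent grows with the temperature, and so does
    every factor of the heating term.\<close>
  have "\<kappa>2 / S \<le> \<kappa>2 / T" using assms pars by (intro divide_left_mono_neg) auto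
  then have "S\<^sup>2 * exp (\<kappa>2 / S) \<le> T\<^sup>2 * exp (\<kappa>2 / T)"
    using assms by (intro mult_mono power_mono) auto
  then have "V * \<kappa>1 * (S\<^sup>2 * exp (\<kappa>2 / S)) \<le> V * \<kappa>1 * (T\<^sup>2 * exp (\<kappa>2 / T))"
    using pars by (intro mult_left_mono) auto
  then show ?thesis
    using assms pars unfolding temp_map_def mult.assoc
    by (intro add_mono mult_left_mono) auto
qed

lemma alpha_pos: "\<alpha> > 0" and beta_pos: "\<beta> > 0"
  using pars unfolding alpha_eq beta_eq
  by (intro mult_neg_neg divide_pos_neg divide_neg_pos mult_pos_pos mult_pos_neg; simp)+

text \<open>The factor in front of \<open>1 - gain \<alpha> \<beta> x\<close> is positive, so this
  identity reduces the direction of motion to comparing \<open>gain\<close> with 1.\<close>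

lemma temp_map_increment:
  assumes "T > 0"
  defines "x \<equiv> - \<kappa>2 / T"
  shows "temp_map a b V \<kappa>1 \<kappa>2 P T - T
    = (1 - a) * (- \<kappa>2) * exp (- x) / (\<beta> * x\<^sup>2) * (1 - gain \<alpha> \<beta> x)"
proof -
  have x: "x > 0" using assms pars by (simp add: divide_neg_pos)
  have T: "T = - \<kappa>2 / x" using assms pars by (simp add: x_def)
  have k: "\<kappa>2 / T = - x" by (simp add: x_def)
  \<comment> \<open>The definitions of \<alpha> and \<beta>, solved for the constant heating and for
    the coefficient of the exponential heating.\<close>
  have P: "b * P = (1 - a) * (- \<kappa>2) * \<alpha>" using pars by (simp add: alpha_eq field_simps)
  have V: "b * V * \<kappa>1 * (- \<kappa>2) * \<beta> = 1 - a" using pars by (simp add: beta_eq field_simps)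
  have e: "exp (- x) * exp x = 1" by (simp add: exp_minus)
  \<comment> \<open>Expanding \<open>1 - gain\<close>: the 1 yields the exponential heating term. In
    the rest the exponentials cancel, leaving the loss \<open>(1 - a) * T\<close> and the constant
    heating \<open>b * P\<close>.\<close>
  have "(1 - a) * (- \<kappa>2) * exp (- x) / (\<beta> * x\<^sup>2) * (1 - gain \<alpha> \<beta> x)
    = (1 - a) * (- \<kappa>2) * exp (- x) / (\<beta> * x\<^sup>2)
      - (1 - a) * (- \<kappa>2) * (exp (- x) * exp x) * (1 - \<alpha> * x) / x"
    using x beta_pos by (simp add: gain_def field_simps power2_eq_square)
  also have "\<dots> = (1 - a) * (- \<kappa>2) / (\<beta> * x\<^sup>2) * exp (- x)
      - (1 - a) * (- \<kappa>2) / x + (1 - a) * (- \<kappa>2) * \<alpha>"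
    unfolding e using x by (simp add: field_simps)
  also have "(1 - a) * (- \<kappa>2) / (\<beta> * x\<^sup>2) = b * V * \<kappa>1 * T\<^sup>2"
    unfolding V[symmetric] T using x beta_pos by (simp add: field_simps power2_eq_square)
  also have "(1 - a) * (- \<kappa>2) / x = (1 - a) * T" by (simp add: T)
  also have "(1 - a) * (- \<kappa>2) * \<alpha> = b * P" by (simp add: P)
  finally show ?thesis by (simp add: temp_map_def k algebra_simps)
qed

lemma temp_map_sign:
  assumes "T > 0"
  shows "T < temp_map a b V \<kappa>1 \<kappa>2 P T \<longleftrightarrow> gain \<alpha> \<beta> (- \<kappa>2 / T) < 1"
    and "temp_map a b V \<kappa>1 \<kappa>2 P T < T \<longleftrightarrow> gain \<alpha> \<beta> (- \<kappa>2 / T) > 1"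
proof -
  define C where "C = (1 - a) * (- \<kappa>2) * exp (- (- \<kappa>2 / T)) / (\<beta> * (- \<kappa>2 / T)\<^sup>2)"
  have "C > 0"
    unfolding C_def using assms pars beta_pos by (intro divide_pos_pos mult_pos_pos) auto
  moreover have "temp_map a b V \<kappa>1 \<kappa>2 P T - T = C * (1 - gain \<alpha> \<beta> (- \<kappa>2 / T))"
    unfolding C_def by (rule temp_map_increment[OF assms])
  ultimately have "0 < temp_map a b V \<kappa>1 \<kappa>2 P T - T \<longleftrightarrow> 0 < 1 - gain \<alpha> \<beta> (- \<kappa>2 / T)"
    and "temp_map a b V \<kappa>1 \<kappa>2 P T - T < 0 \<longleftrightarrow> 1 - gain \<alpha> \<beta> (- \<kappa>2 / T) < 0"
    by (simp_all only: zero_less_mult_iff mult_less_0_iff) auto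
  then show "T < temp_map a b V \<kappa>1 \<kappa>2 P T \<longleftrightarrow> gain \<alpha> \<beta> (- \<kappa>2 / T) < 1"
    and "temp_map a b V \<kappa>1 \<kappa>2 P T < T \<longleftrightarrow> gain \<alpha> \<beta> (- \<kappa>2 / T) > 1"
    by linarith+
qed

text \<open>At level 1 both strict inequalities of \<open>temp_map_sign\<close> fail, which leaves
  equality.\<close>

lemma fixed_point_temp_map:
  assumes "x > 0" "gain \<alpha> \<beta> x = 1"
  shows "fixed_point (temp_map a b V \<kappa>1 \<kappa>2 P) (- \<kappa>2 / x)"
proof -
  have "- \<kappa>2 / x > 0" using assms pars by (simp add: divide_neg_pos)
  moreover have "- \<kappa>2 / (- \<kappa>2 / x) = x" using pars by simp
  ultimately show ?thesis
    using temp_map_sign[of "- \<kappa>2 / x"] assms by (auto simp: fixed_point_def not_less_iff_gr_or_eq)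
qed

section \<open>Long-term behaviour of temperature iterations\<close>

lemma temp_map_runaway:
  assumes it: "iteration (temp_map a b V \<kappa>1 \<kappa>2 P) T"
    and low: "\<And>x. 0 < x \<Longrightarrow> x \<le> - \<kappa>2 / T 0 \<Longrightarrow> gain \<alpha> \<beta> x < 1"
  shows "(\<lambda>k. - \<kappa>2 / T k) \<longlonglongrightarrow> 0 \<and> filterlim T at_top sequentially"
proof
  have T0: "T 0 > 0" using it by (simp add: iteration_def)
  show "filterlim T at_top sequentially"
  proof (rule orbit_at_top)
    show "T (Suc k) = temp_map a b V \<kappa>1 \<kappa>2 P (T k)" for k using it by (simp add: iteration_def)
    fix z assume z: "T 0 \<le> z"
    \<comment> \<open>Passing from T to -\<kappa>2/T reverses the order: temperatures from
      \<open>T 0\<close> upwards correspond to the points that \<open>low\<close> covers.\<close>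
    then have "- \<kappa>2 / z > 0" "- \<kappa>2 / z \<le> - \<kappa>2 / T 0"
      using T0 pars by (intro divide_pos_pos divide_left_mono; simp)+
    then show "z < temp_map a b V \<kappa>1 \<kappa>2 P z" using temp_map_sign(1)[of z] low z T0 by simp
    show "isCont (temp_map a b V \<kappa>1 \<kappa>2 P) z" using z T0 isCont_temp_map by simp
  qed
  then show "(\<lambda>k. - \<kappa>2 / T k) \<longlonglongrightarrow> 0"
    by (intro real_tendsto_divide_at_top[OF tendsto_const])
qed

text \<open>By order reversal, \<open>- \<kappa>2 / s\<close> is the lower fixed temperature. Below
  it x exceeds \<open>s\<close> and the map heats; between the two fixed temperatures
  \<open>gain\<close> exceeds 1 and the map cools.\<close>

lemma temp_map_tendsto:
  assumes it: "iteration (temp_map a b V \<kappa>1 \<kappa>2 P) T"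
    and us: "0 < u" "u < s" "gain \<alpha> \<beta> u = 1" "gain \<alpha> \<beta> s = 1"
    and start: "T 0 < - \<kappa>2 / u"
  shows "T \<longlonglongrightarrow> - \<kappa>2 / s"
proof -
  have step: "T (Suc k) = temp_map a b V \<kappa>1 \<kappa>2 P (T k)" for k using it by (simp add: iteration_def)
  have T0: "T 0 > 0" using it by (simp add: iteration_def)
  have fp: "- \<kappa>2 / s > 0" "temp_map a b V \<kappa>1 \<kappa>2 P (- \<kappa>2 / s) = - \<kappa>2 / s"
    using fixed_point_temp_map[of s] us by (auto simp: fixed_point_def)
  note level = gain_level_1[OF alpha_pos beta_pos us]
  have mono: "mono_on {l..r} (temp_map a b V \<kappa>1 \<kappa>2 P)" if "l > 0" for l r
    using that by (auto intro!: mono_onI temp_map_mono)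
  show ?thesis
  proof (cases "T 0 \<le> - \<kappa>2 / s")
    case True
    show ?thesis
    proof (rule orbit_tendsto_increasing[where f = "temp_map a b V \<kappa>1 \<kappa>2 P" and T = T, OF step True fp(2) _ mono[OF T0]])
      fix z assume z: "T 0 \<le> z" "z < - \<kappa>2 / s"
      then have "s < - \<kappa>2 / z" using T0 us by (simp add: field_simps)
      then show "z < temp_map a b V \<kappa>1 \<kappa>2 P z" using temp_map_sign(1)[of z] level(5) z T0 by simp
    qed (use T0 isCont_temp_map in auto)
  next
    case False
    show ?thesis
    proof (rule orbit_tendsto_decreasing[where f = "temp_map a b V \<kappa>1 \<kappa>2 P" and T = T, OF step _ fp(2) _ mono[OF fp(1)]])
      fix z assume z: "- \<kappa>2 / s < z" "z \<le> T 0"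
      then have z0: "z > 0" "z < - \<kappa>2 / u" using fp(1) start by linarith+
      then have "u < - \<kappa>2 / z" "- \<kappa>2 / z < s" using z us by (auto simp: field_simps)
      then show "temp_map a b V \<kappa>1 \<kappa>2 P z < z" using temp_map_sign(2)[of z] level(4) z0 by simp
    next
      fix z assume "- \<kappa>2 / s \<le> z"
      then show "isCont (temp_map a b V \<kappa>1 \<kappa>2 P) z" using fp(1) isCont_temp_map by simp
    qed (use False in simp)
  qed
qed

lemma temp_map_runaway_below:
  assumes it: "iteration (temp_map a b V \<kappa>1 \<kappa>2 P) T"
    and us: "0 < u" "u < s" "gain \<alpha> \<beta> u = 1" "gain \<alpha> \<beta> s = 1"
    and start: "- \<kappa>2 / T 0 < u"
  shows "(\<lambda>k. - \<kappa>2 / T k) \<longlonglongrightarrow> 0 \<and> filterlim T at_top sequentially"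
  using gain_level_1(3)[OF alpha_pos beta_pos us] start
  by (intro temp_map_runaway[OF it]) simp

text \<open>Every start slightly hotter than this fixed point has x below \<open>u\<close> and runs
  away, so no neighbourhood is attracted.\<close>

lemma temp_map_unstable:
  assumes us: "0 < u" "u < s" "gain \<alpha> \<beta> u = 1" "gain \<alpha> \<beta> s = 1"
  shows "unstable_fixed_point (temp_map a b V \<kappa>1 \<kappa>2 P) (- \<kappa>2 / u)"
proof -
  let ?f = "temp_map a b V \<kappa>1 \<kappa>2 P" and ?p = "- \<kappa>2 / u"
  have fp: "fixed_point ?f ?p" using fixed_point_temp_map us by simp
  then have p: "?p > 0" by (simp add: fixed_point_def)
  have "\<exists>T. iteration ?f T \<and> \<bar>T 0 - ?p\<bar> < \<epsilon> \<and> \<not> T \<longlonglongrightarrow> ?p" if "\<epsilon> > 0" for \<epsilon>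
  proof (intro exI conjI)
    \<comment> \<open>The orbit starting \<epsilon>/2 above the fixed temperature serves as the
      counterexample.\<close>
    define T where "T = (\<lambda>k. (?f ^^ k) (?p + \<epsilon> / 2))"
    have T0: "T 0 = ?p + \<epsilon> / 2" by (simp add: T_def)
    show it: "iteration ?f T" using add_pos_pos[OF p half_gt_zero[OF that]] by (simp add: iteration_def T_def)
    show "\<bar>T 0 - ?p\<bar> < \<epsilon>" using that unfolding T0 by simp
    have "T 0 > 0" "?p < T 0" using p that unfolding T0 by linarith+
    then have "- \<kappa>2 / T 0 < u" using us by (simp add: field_simps)
    then have "filterlim T at_top sequentially" using temp_map_runaway_below[OF it us] by simp
    then show "\<not> T \<longlonglongrightarrow> ?p"
      using not_tendsto_and_filterlim_at_infinity[OF sequentially_bot]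
        filterlim_at_top_imp_at_infinity by blast
  qed
  then show ?thesis using fp by (auto simp: unstable_fixed_point_def attracts_nearby_def)
qed

text \<open>All positive temperatures below the unstable one are attracted, so the distance between
  the two fixed temperatures serves as the radius \<epsilon>.\<close>

lemma temp_map_stable:
  assumes us: "0 < u" "u < s" "gain \<alpha> \<beta> u = 1" "gain \<alpha> \<beta> s = 1"
  shows "stable_fixed_point (temp_map a b V \<kappa>1 \<kappa>2 P) (- \<kappa>2 / s)"
proof -
  have gap: "- \<kappa>2 / s < - \<kappa>2 / u"
    using us pars by (intro divide_strict_left_mono) auto
  have "T \<longlonglongrightarrow> - \<kappa>2 / s"
    if "iteration (temp_map a b V \<kappa>1 \<kappa>2 P) T" "\<bar>T 0 - - \<kappa>2 / s\<bar> < - \<kappa>2 / u - - \<kappa>2 / s" for T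
    using temp_map_tendsto[OF that(1) us] that(2) by linarith
  then have "attracts_nearby (temp_map a b V \<kappa>1 \<kappa>2 P) (- \<kappa>2 / s)"
    unfolding attracts_nearby_def using gap
    by (intro exI[of _ "- \<kappa>2 / u - - \<kappa>2 / s"]) auto
  then show ?thesis using fixed_point_temp_map us by (simp add: stable_fixed_point_def)
qed

end

section \<open>Thermal runaway and stability in terms of \<open>calF\<close>\<close>

theorem theorem4p4:
  fixes a b V \<kappa>1 \<kappa>2 P\<^sub>C \<alpha> \<beta> x\<^sub>m :: real and f :: "real \<Rightarrow> real"
  assumes "0 < a" "a < 1" "b > 0" "V > 0" "\<kappa>1 > 0" "\<kappa>2 < 0" "P\<^sub>C > 0"
    and f_eq: "f = temp_map a b V \<kappa>1 \<kappa>2 P\<^sub>C"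
    and alpha_eq: "\<alpha> = b / (a - 1) * (P\<^sub>C / \<kappa>2)"
    and beta_eq: "\<beta> = (a - 1) / b * (1 / (V * \<kappa>1 * \<kappa>2))"
    and xm_eq: "x\<^sub>m = 1 / (2 * \<alpha>) - 1 + sqrt (1 / (4 * \<alpha>\<^sup>2) + 1)"
  shows "\<alpha> > 0 \<and> \<beta> > 0
    \<and> (\<forall>T. iteration f T \<longrightarrow> (\<forall>k. - \<kappa>2 / T k \<in> {0<..}))
    \<and> ((\<nexists>x. F_solution \<alpha> \<beta> x) \<longrightarrow>
         (\<forall>T. iteration f T \<longrightarrow>
            ((\<lambda>k. - \<kappa>2 / T k) \<longlonglongrightarrow> 0) \<and> filterlim T at_top sequentially))
    \<and> (\<forall>x y. F_solution \<alpha> \<beta> x \<and> F_solution \<alpha> \<beta> y \<and> x \<noteq> y \<longrightarrow>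
         (\<exists>x\<^sub>u x\<^sub>s. {x\<^sub>u, x\<^sub>s} = {x, y}
            \<and> x\<^sub>u \<in> {0<..<x\<^sub>m} \<and> unstable_fixed_point f (- \<kappa>2 / x\<^sub>u)
            \<and> x\<^sub>s \<in> {x\<^sub>m<..<1 / \<alpha>} \<and> stable_fixed_point f (- \<kappa>2 / x\<^sub>s)
            \<and> (\<forall>T. iteration f T \<and> - \<kappa>2 / T 0 \<in> {0<..<x\<^sub>u} \<longrightarrow>
                 ((\<lambda>k. - \<kappa>2 / T k) \<longlonglongrightarrow> 0) \<and> filterlim T at_top sequentially)
            \<and> (\<forall>T. iteration f T \<and> - \<kappa>2 / T 0 \<in> {x\<^sub>u<..<1 / \<alpha>} \<longrightarrow>
                 ((\<lambda>k. - \<kappa>2 / T k) \<longlonglongrightarrow> x\<^sub>s))))"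
proof -
  note pars = assms(1-7) alpha_eq beta_eq
  have pos: "\<alpha> > 0" "\<beta> > 0" by (rule alpha_pos[OF pars] beta_pos[OF pars])+
  have xm: "x\<^sub>m = peak \<alpha>" by (simp add: xm_eq peak_def)
  have Tpos: "T k > 0" if "iteration f T" for T k
    using iteration_temp_map_pos[OF pars] that f_eq by simp
  have orbit_pos: "- \<kappa>2 / T k \<in> {0<..}" if "iteration f T" for T k
    using Tpos[OF that] assms(6) by (simp add: divide_neg_pos)
  have two: "\<exists>x\<^sub>u x\<^sub>s. {x\<^sub>u, x\<^sub>s} = {x, y}
            \<and> x\<^sub>u \<in> {0<..<x\<^sub>m} \<and> unstable_fixed_point f (- \<kappa>2 / x\<^sub>u)
            \<and> x\<^sub>s \<in> {x\<^sub>m<..<1 / \<alpha>} \<and> stable_fixed_point f (- \<kappa>2 / x\<^sub>s)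
            \<and> (\<forall>T. iteration f T \<and> - \<kappa>2 / T 0 \<in> {0<..<x\<^sub>u} \<longrightarrow>
                 ((\<lambda>k. - \<kappa>2 / T k) \<longlonglongrightarrow> 0) \<and> filterlim T at_top sequentially)
            \<and> (\<forall>T. iteration f T \<and> - \<kappa>2 / T 0 \<in> {x\<^sub>u<..<1 / \<alpha>} \<longrightarrow>
                 ((\<lambda>k. - \<kappa>2 / T k) \<longlonglongrightarrow> x\<^sub>s))"
    if sol: "F_solution \<alpha> \<beta> x" "F_solution \<alpha> \<beta> y" and "x \<noteq> y" for x y
  proof -
    \<comment> \<open>The two solutions come unordered; the smaller one will be the unstable
      one.\<close>
    define u s where "u = min x y" and "s = max x y"
    have "F_solution \<alpha> \<beta> u" "F_solution \<alpha> \<beta> s" using sol by (auto simp: u_def s_def min_def max_def)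
    then have us: "0 < u" "u < s" "gain \<alpha> \<beta> u = 1" "gain \<alpha> \<beta> s = 1" and s: "s < 1 / \<alpha>"
      using F_solution_iff_gain[OF pos] \<open>x \<noteq> y\<close> by (auto simp: u_def s_def)
    \<comment> \<open>This holds for all starts beyond \<open>u\<close>, including those at or above
      1/\<alpha>.\<close>
    have limit: "(\<lambda>k. - \<kappa>2 / T k) \<longlonglongrightarrow> s"
      if it: "iteration f T" and "u < - \<kappa>2 / T 0" for T
    proof -
      have "T 0 < - \<kappa>2 / u" using that(2) us(1) Tpos[OF it, of 0] by (simp add: field_simps)
      then have "T \<longlonglongrightarrow> - \<kappa>2 / s"
        using temp_map_tendsto[OF pars it[unfolded f_eq] us] by simp
      then have "(\<lambda>k. - \<kappa>2 / T k) \<longlonglongrightarrow> - \<kappa>2 / (- \<kappa>2 / s)"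
        using assms(6) us by (intro tendsto_intros) auto
      then show ?thesis using assms(6) by simp
    qed
    have "{u, s} = {x, y}" by (auto simp: u_def s_def min_def max_def)
    then show ?thesis
      using us(1) s gain_level_1(1,2)[OF pos us] limit
        temp_map_unstable[OF pars us] temp_map_stable[OF pars us]
        temp_map_runaway_below[OF pars _ us]
      by (intro exI[of _ u] exI[of _ s]) (simp add: f_eq xm)
  qed
  have none: "((\<lambda>k. - \<kappa>2 / T k) \<longlonglongrightarrow> 0) \<and> filterlim T at_top sequentially"
    if "\<nexists>x. F_solution \<alpha> \<beta> x" "iteration f T" for T
    using temp_map_runaway[OF pars that(2)[unfolded f_eq]]
      gain_less_1_if_no_solution[OF pos that(1)] by blast
  show ?thesis using pos orbit_pos none two by blast
qed

end
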